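(* Let $a,b\in\mathbb{R}_+$ with $a\neq b$. The function $(p,q)\mapsto\mathcal{H}_{D}(p,q;a,b)$ is strictly bivariate log-convex on $(0,\infty)\times(0,\infty)$ and bivariate log-concave on $(-\infty,0)\times(-\infty,0)$.
   Context: Notation: $\mathbb{R}_+=(0,\infty)$; $I(x,y)=e^{-1}(x^x/y^y)^{1/(x-y)}$ for $x,y>0$, $x\neq y$, is the identric (exponential) mean. The two-parameter homogeneous function of difference is defined, for $a,b\in\mathbb{R}_+$ with $a\ne b$ and $p,q\neq0$, by $$\mathcal{H}_D(p,q;a,b)=\left|\frac{a^p-b^p}{a^q-b^q}\right|^{1/(p-q)}\ \text{if } p\neq q,\qquad \mathcal{H}_D(p,p;a,b)=e^{1/p}\left(I(a^p,b^p)\right)^{1/p}\ \text{if } p=q.$$ A positive function $\Psi$ on a convex domain $\Omega\subseteq\mathbb{R}^2$ is (strictly) bivariate log-convex if $\ln\Psi$ is (strictly) convex as a function of two variables on $\Omega$, and (strictly) bivariate log-concave if $\ln\Psi$ is (strictly) concave there. *)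

theory Defs
  imports "HOL-Analysis.Analysis"
begin

text \<open>The identric mean; the formula is meaningful for \<open>x, y > 0\<close> and \<open>x \<noteq> y\<close> only.\<close>

definition identric_mean :: "real \<Rightarrow> real \<Rightarrow> real" where
  "identric_mean x y = exp (- 1) * ((x powr x) / (y powr y)) powr (1 / (x - y))"

text \<open>Meaningful for \<open>a, b > 0\<close>, \<open>a \<noteq> b\<close> and \<open>p, q \<noteq> 0\<close> only; outside this range the value
  is an artefact of the total operations \<open>/\<close> and \<open>powr\<close>.\<close>

definition H_D :: "real \<Rightarrow> real \<Rightarrow> real \<Rightarrow> real \<Rightarrow> real" where
  "H_D p q a b =
     (if p \<noteq> q then \<bar>(a powr p - b powr p) / (a powr q - b powr q)\<bar> powr (1 / (p - q))
      else exp (1 / p) * identric_mean (a powr p) (b powr p) powr (1 / p))"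

definition strictly_convex_on :: "'a::real_vector set \<Rightarrow> ('a \<Rightarrow> real) \<Rightarrow> bool" where
  "strictly_convex_on S f \<longleftrightarrow> convex S \<and>
     (\<forall>x\<in>S. \<forall>y\<in>S. \<forall>u>0. \<forall>v>0. x \<noteq> y \<longrightarrow> u + v = 1 \<longrightarrow>
        f (u *\<^sub>R x + v *\<^sub>R y) < u * f x + v * f y)"

text \<open>Convexity of the domain is part of \<^const>\<open>strictly_convex_on\<close> and \<^const>\<open>concave_on\<close>.\<close>

definition strictly_bivariate_log_convex_on :: "(real \<times> real) set \<Rightarrow> (real \<times> real \<Rightarrow> real) \<Rightarrow> bool" where
  "strictly_bivariate_log_convex_on S \<Psi> \<longleftrightarrow>
     (\<forall>z\<in>S. \<Psi> z > 0) \<and> strictly_convex_on S (\<lambda>z. ln (\<Psi> z))"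

definition bivariate_log_concave_on :: "(real \<times> real) set \<Rightarrow> (real \<times> real \<Rightarrow> real) \<Rightarrow> bool" where
  "bivariate_log_concave_on S \<Psi> \<longleftrightarrow>
     (\<forall>z\<in>S. \<Psi> z > 0) \<and> concave_on S (\<lambda>z. ln (\<Psi> z))"

end

theory Submission
  imports Defs
begin

text \<open>Put \<open>m = (ln a + ln b) / 2\<close> and \<open>c = (ln a - ln b) / 2\<close>. Then
  \<open>a\<^sup>t - b\<^sup>t = 2 exp (m t) sinh (c t)\<close>, so \<open>ln \<bar>a\<^sup>t - b\<^sup>t\<bar>\<close> has derivative
  \<open>m + c coth (c t)\<close>, and \<open>ln H_D\<close> at \<open>(p, q)\<close> is the mean value of this derivative over the
  segment from \<open>q\<close> to \<open>p\<close>, also when \<open>p = q\<close>. Averaging over segments carries strict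
  convexity of \<open>t \<mapsto> c coth (c t)\<close> on the positive half-line over to joint strict convexity in
  \<open>(p, q)\<close>; as this function is odd, the negative quadrant follows by reflection.\<close>

section \<open>Strict convexity and a derivative criterion for it\<close>

lemma strictly_convex_onD:
  assumes "strictly_convex_on S f" "x \<in> S" "y \<in> S" "u > 0" "v > 0" "x \<noteq> y" "u + v = 1"
  shows "f (u *\<^sub>R x + v *\<^sub>R y) < u * f x + v * f y"
  using assms by (simp add: strictly_convex_on_def)

text \<open>The mean value theorem on each side of an intermediate point yields two slopes, and a
  strictly increasing derivative makes the left one smaller.\<close>

lemma strictly_convex_on_realI:
  fixes f f' :: "real \<Rightarrow> real"
  assumes S: "convex S"
    and deriv: "\<And>x. x \<in> S \<Longrightarrow> (f has_real_derivative f' x) (at x)"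
    and mono: "strict_mono_on S f'"
  shows "strictly_convex_on S f"
proof -
  \<comment> \<open>The case \<open>y < x\<close> reduces to this one by exchanging the two points
    together with their weights.\<close>
  have *: "f (u * x + v * y) < u * f x + v * f y"
    if x: "x \<in> S" and y: "y \<in> S" and u: "u > 0" and v: "v > 0" and "x < y" and uv: "u + v = 1"
    for x y u v
  proof -
    define z where "z = u * x + v * y"
    have u_eq: "u = 1 - v"
      using uv by simp
    have zx: "z - x = v * (y - x)" and yz: "y - z = u * (y - x)"
      by (simp_all add: z_def u_eq algebra_simps)
    have "x < z" "z < y"
      using zx yz mult_pos_pos[OF v, of "y - x"] mult_pos_pos[OF u, of "y - x"] \<open>x < y\<close> by auto
    have seg: "w \<in> S" if "x \<le> w" "w \<le> y" for w
      using S x y that mem_is_interval_1_I[of S x y w] by (simp add: is_interval_convex_1)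
    obtain \<xi> where \<xi>: "x < \<xi>" "\<xi> < z" "f z - f x = (z - x) * f' \<xi>"
      using MVT2[OF \<open>x < z\<close>, of f f', OF deriv] seg \<open>z < y\<close> by auto
    obtain \<eta> where \<eta>: "z < \<eta>" "\<eta> < y" "f y - f z = (y - z) * f' \<eta>"
      using MVT2[OF \<open>z < y\<close>, of f f', OF deriv] seg \<open>x < z\<close> by auto
    have "f' \<xi> < f' \<eta>"
      using \<xi> \<eta> seg by (intro strict_mono_onD[OF mono]) auto
    \<comment> \<open>Both increments take the factor \<open>u * v * (y - x)\<close>, because
      \<open>u * (z - x) = v * (y - z)\<close>.\<close>
    then have "u * v * (y - x) * f' \<xi> < u * v * (y - x) * f' \<eta>"
      using u v \<open>x < y\<close> by (intro mult_strict_left_mono) auto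
    then have "u * (f z - f x) < v * (f y - f z)"
      using \<xi>(3) \<eta>(3) by (simp add: zx yz mult_ac)
    then have "f z < u * f x + v * f y"
      by (simp add: u_eq algebra_simps)
    then show ?thesis
      by (simp add: z_def)
  qed
  show ?thesis
    unfolding strictly_convex_on_def
  proof (intro conjI ballI allI impI S)
    fix x y u v :: real
    assume h: "x \<in> S" "y \<in> S" "0 < u" "0 < v" "x \<noteq> y" "u + v = 1"
    then consider "x < y" | "y < x" by linarith
    then show "f (u *\<^sub>R x + v *\<^sub>R y) < u * f x + v * f y"
      using *[of x y u v] *[of y x v u] h by cases (simp_all add: add.commute)
  qed
qed

section \<open>Means over segments\<close>

text \<open>Integrating over the parameter \<open>s\<close>, with no division by the length of the
  segment, also covers the diagonal and makes the argument of \<open>g\<close> linear in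
  \<open>z\<close> for each fixed \<open>s\<close>.\<close>

definition segment_mean :: "(real \<Rightarrow> real) \<Rightarrow> real \<times> real \<Rightarrow> real" where
  "segment_mean g z = integral {0..1} (\<lambda>s. g (s * fst z + (1 - s) * snd z))"

lemma segment_mean_diag [simp]: "segment_mean g (p, p) = g p"
  by (simp add: segment_mean_def algebra_simps)

lemma segment_mean_odd:
  assumes "\<And>t. g (- t) = - g t"
  shows "segment_mean g (- z) = - segment_mean g z"
proof -
  have "g (s * fst (- z) + (1 - s) * snd (- z)) = - g (s * fst z + (1 - s) * snd z)" for s
    using assms[of "s * fst z + (1 - s) * snd z"] by (simp add: algebra_simps)
  then show ?thesis
    by (simp add: segment_mean_def)
qed

text \<open>By the chain rule \<open>f (s * p + (1 - s) * q) / (p - q)\<close> is an antiderivative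
  of the integrand in \<open>s\<close>; convexity keeps the segment inside \<open>S\<close>.\<close>

lemma segment_mean_deriv:
  fixes f g :: "real \<Rightarrow> real"
  assumes S: "convex S" and "p \<in> S" "q \<in> S" "p \<noteq> q"
    and deriv: "\<And>t. t \<in> S \<Longrightarrow> (f has_real_derivative g t) (at t)"
  shows "segment_mean g (p, q) = (f p - f q) / (p - q)"
proof -
  have "((\<lambda>s. g (s * p + (1 - s) * q)) has_integral
      f (1 * p + (1 - 1) * q) / (p - q) - f (0 * p + (1 - 0) * q) / (p - q)) {0..1}"
  proof (rule fundamental_theorem_of_calculus)
    fix s :: real assume s: "s \<in> {0..1}"
    have "s * p + (1 - s) * q \<in> S"
      using convexD[OF S, of p q s "1 - s"] assms s by simp
    from DERIV_chain2[where f = f and g = "\<lambda>s. s * p + (1 - s) * q", OF deriv[OF this], of "p - q" UNIV]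
    have "((\<lambda>s. f (s * p + (1 - s) * q)) has_real_derivative
        g (s * p + (1 - s) * q) * (p - q)) (at s)"
      by (rule meta_mp) (auto intro!: derivative_eq_intros)
    from DERIV_cdivide[OF this, of "p - q"]
    have "((\<lambda>s. f (s * p + (1 - s) * q) / (p - q)) has_real_derivative
        g (s * p + (1 - s) * q)) (at s)"
      using \<open>p \<noteq> q\<close> by simp
    then show "((\<lambda>s. f (s * p + (1 - s) * q) / (p - q)) has_vector_derivative
        g (s * p + (1 - s) * q)) (at s within {0..1})"
      by (simp add: has_real_derivative_iff_has_vector_derivative has_vector_derivative_at_within)
  qed simp
  then show ?thesis
    by (simp add: segment_mean_def integral_unique diff_divide_distrib)
qed

text \<open>The integrand inherits the convexity inequality for each \<open>s\<close>, but it may be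
  an equality at a parameter where the two segments meet. Continuity restores strictness: one
  parameter with a strict inequality is enough.\<close>

lemma strictly_convex_on_segment_mean:
  assumes g: "strictly_convex_on S g" and cont: "continuous_on S g"
  shows "strictly_convex_on (S \<times> S) (segment_mean g)"
proof -
  have S: "convex S"
    using g by (simp add: strictly_convex_on_def)
  show ?thesis
    unfolding strictly_convex_on_def
  proof (intro conjI ballI allI impI convex_Times S)
    fix z w :: "real \<times> real" and u v :: real
    assume z: "z \<in> S \<times> S" and w: "w \<in> S \<times> S" and u: "0 < u" and v: "0 < v"
      and ne: "z \<noteq> w" and uv: "u + v = 1"
    define l where "l z s = s * fst z + (1 - s) * snd z" for z :: "real \<times> real" and s
    have l_in: "l y s \<in> S" if "y \<in> S \<times> S" "s \<in> {0..1}" for y s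
      using convexD[OF S, of "fst y" "snd y" s "1 - s"] that by (auto simp: l_def)
    have l_conv: "l (u *\<^sub>R z + v *\<^sub>R w) s = u * l z s + v * l w s" for s
      by (simp add: l_def algebra_simps)
    have zw: "u *\<^sub>R z + v *\<^sub>R w \<in> S \<times> S"
      using convexD[OF convex_Times[OF S S] z w, of u v] u v uv by simp
    have cl: "continuous_on {0..1} (\<lambda>s. g (l y s))" if "y \<in> S \<times> S" for y
      by (rule continuous_on_compose2[OF cont])
        (use that l_in in \<open>auto simp: l_def intro!: continuous_intros\<close>)
    \<comment> \<open>The convexity defect at parameter \<open>s\<close>; its integral is the defect
      of \<open>segment_mean g\<close>.\<close>
    define d where "d s = u * g (l z s) + v * g (l w s) - g (l (u *\<^sub>R z + v *\<^sub>R w) s)" for s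
    have d_pos: "0 < d s" if "s \<in> {0..1}" "l z s \<noteq> l w s" for s
      using strictly_convex_onD[OF g l_in[OF z] l_in[OF w] u v _ uv, of s s] that
      by (simp add: d_def l_conv)
    have d_nonneg: "0 \<le> d s" if "s \<in> {0..1}" for s
    proof (cases "l z s = l w s")
      case True
      then show ?thesis
        using uv by (simp add: d_def l_conv flip: distrib_right)
    qed (use d_pos[OF that] in simp)
    have cd: "continuous_on {0..1} d"
      unfolding d_def by (intro continuous_intros cl z w zw)
    have "\<exists>s\<in>{0..1}. l z s \<noteq> l w s"
    proof -
      \<comment> \<open>The parameters 0 and 1 return the second and the first coordinate, and
        distinct pairs differ in one of them.\<close>
      have "l z 0 \<noteq> l w 0 \<or> l z 1 \<noteq> l w 1"
        using ne by (auto simp: l_def prod_eq_iff)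
      then show ?thesis by (auto intro: bexI[of _ 0] bexI[of _ 1])
    qed
    then obtain s where "s \<in> {0..1}" "d s \<noteq> 0"
      using d_pos by fastforce
    then have "integral {0..1} d \<noteq> 0"
      using integral_eq_0_iff[OF cd] d_nonneg by auto
    moreover have "0 \<le> integral {0..1} d"
      by (intro integral_nonneg integrable_continuous_interval cd d_nonneg)
    moreover have "integral {0..1} d
        = u * segment_mean g z + v * segment_mean g w - segment_mean g (u *\<^sub>R z + v *\<^sub>R w)"
    proof -
      have i: "((\<lambda>s. g (l y s)) has_integral segment_mean g y) {0..1}" if "y \<in> S \<times> S" for y
        using integrable_integral[OF integrable_continuous_interval[OF cl[OF that]]]
        by (simp add: segment_mean_def l_def)
      show ?thesis
        unfolding d_def
        by (intro integral_unique has_integral_diff has_integral_add has_integral_mult_right i z w zw)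
    qed
    ultimately show "segment_mean g (u *\<^sub>R z + v *\<^sub>R w) < u * segment_mean g z + v * segment_mean g w"
      by linarith
  qed
qed

section \<open>The scaled hyperbolic cotangent\<close>

lemma scaled_coth_deriv:
  fixes c t :: real
  assumes "c * t \<noteq> 0"
  shows "((\<lambda>t. c * cosh (c * t) / sinh (c * t)) has_real_derivative - (c\<^sup>2) / (sinh (c * t))\<^sup>2) (at t)"
proof -
  have "((\<lambda>t. c * cosh (c * t) / sinh (c * t)) has_real_derivative
      (c * (sinh (c * t) * c) * sinh (c * t) - c * cosh (c * t) * (cosh (c * t) * c))
        / (sinh (c * t) * sinh (c * t))) (at t)"
    using assms by (auto intro!: derivative_eq_intros)
  moreover have "c * (sinh (c * t) * c) * sinh (c * t) - c * cosh (c * t) * (cosh (c * t) * c) = - (c\<^sup>2)"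
    using cosh_square_eq[of "c * t"] by (simp add: power2_eq_square algebra_simps)
  ultimately show ?thesis
    by (simp add: power2_eq_square)
qed

lemma strictly_convex_on_scaled_coth:
  fixes c :: real
  assumes "c \<noteq> 0"
  shows "strictly_convex_on {0<..} (\<lambda>t. c * cosh (c * t) / sinh (c * t))"
proof (rule strictly_convex_on_realI)
  show "strict_mono_on {0<..} (\<lambda>t. - (c\<^sup>2) / (sinh (c * t))\<^sup>2)"
  proof (rule strict_mono_onI)
    fix r s :: real assume rs: "r \<in> {0<..}" "s \<in> {0<..}" "r < s"
    \<comment> \<open>Passing to the absolute value of \<open>c\<close> covers both signs at once:
      the hyperbolic sine is then positive and increasing along the half-line.\<close>
    have abs_eq: "(sinh (c * t))\<^sup>2 = (sinh (\<bar>c\<bar> * t))\<^sup>2" for t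
      by (simp add: abs_if)
    have "0 < sinh (\<bar>c\<bar> * r)" "sinh (\<bar>c\<bar> * r) < sinh (\<bar>c\<bar> * s)"
      using rs assms by (simp_all add: mult_strict_left_mono)
    then have "0 < (sinh (c * r))\<^sup>2" "(sinh (c * r))\<^sup>2 < (sinh (c * s))\<^sup>2"
      by (auto simp: abs_eq intro: power_strict_mono)
    then show "- (c\<^sup>2) / (sinh (c * r))\<^sup>2 < - (c\<^sup>2) / (sinh (c * s))\<^sup>2"
      using assms by (simp add: frac_less2 del: sinh_real_zero_iff zero_less_power2)
  qed
next
  fix t :: real assume "t \<in> {0<..}"
  then show "((\<lambda>t. c * cosh (c * t) / sinh (c * t)) has_real_derivative
      - (c\<^sup>2) / (sinh (c * t))\<^sup>2) (at t)"
    using assms by (intro scaled_coth_deriv) simp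
qed simp

section \<open>The logarithm of \<open>H_D\<close> as a segment mean\<close>

context
  fixes a b m c :: real
  assumes a: "a > 0" and b: "b > 0" and ab: "a \<noteq> b"
  defines "m \<equiv> (ln a + ln b) / 2" and "c \<equiv> (ln a - ln b) / 2"
begin

lemma c_nonzero: "c \<noteq> 0"
  using a b ab by (simp add: c_def)

text \<open>By the choice of \<open>m\<close> and \<open>c\<close>, \<open>ln a = m + c\<close> and
  \<open>ln b = m - c\<close>.\<close>

lemma powr_a_eq: "a powr t = exp (m * t) * exp (c * t)"
  and powr_b_eq: "b powr t = exp (m * t) * exp (- (c * t))"
  using a b by (simp_all add: powr_def m_def c_def field_simps flip: exp_add)

lemma powr_diff_eq: "a powr t - b powr t = 2 * exp (m * t) * sinh (c * t)"
  by (simp add: powr_a_eq powr_b_eq sinh_def algebra_simps)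

lemma powr_diff_nonzero: "t \<noteq> 0 \<Longrightarrow> a powr t - b powr t \<noteq> 0"
  using c_nonzero by (simp add: powr_diff_eq)

lemma ln_abs_powr_diff_deriv:
  assumes "t \<noteq> 0"
  shows "((\<lambda>t. ln \<bar>a powr t - b powr t\<bar>) has_real_derivative
    m + c * cosh (c * t) / sinh (c * t)) (at t)"
proof -
  \<comment> \<open>Half the logarithm of the square replaces the logarithm of the absolute value,
    so that no absolute value has to be differentiated. The identity is used only away from 0, an
    open set around \<open>t\<close>.\<close>
  have eq: "ln \<bar>a powr s - b powr s\<bar> = ln 2 + m * s + ln ((sinh (c * s))\<^sup>2) / 2" if "s \<noteq> 0" for s
  proof -
    have "sinh (c * s) \<noteq> 0"
      using that c_nonzero by simp
    then have "ln ((sinh (c * s))\<^sup>2) = 2 * ln \<bar>sinh (c * s)\<bar>"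
      using ln_realpow[of "\<bar>sinh (c * s)\<bar>" 2] by simp
    with \<open>sinh (c * s) \<noteq> 0\<close> show ?thesis
      by (simp add: powr_diff_eq abs_mult ln_mult)
  qed
  have "sinh (c * t) \<noteq> 0"
    using assms c_nonzero by simp
  then have "((\<lambda>s. ln 2 + m * s + ln ((sinh (c * s))\<^sup>2) / 2) has_real_derivative
      m + c * cosh (c * t) / sinh (c * t)) (at t)"
    by (auto intro!: derivative_eq_intros simp: zero_less_power2) (simp add: power2_eq_square)
  then show ?thesis
    by (rule has_field_derivative_transform_within_open[of _ _ _ "- {0}"])
      (use assms in \<open>auto simp: eq\<close>)
qed

lemma H_D_pos:
  assumes "p \<noteq> 0" "q \<noteq> 0"
  shows "H_D p q a b > 0"
  using powr_diff_nonzero[OF assms(1)] powr_diff_nonzero[OF assms(2)] a b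
  by (simp add: H_D_def identric_mean_def)

lemma ln_H_D_diag:
  assumes "p \<noteq> 0"
  shows "ln (H_D p p a b) = m + c * cosh (c * p) / sinh (c * p)"
proof -
  define A B where "A = a powr p" and "B = b powr p"
  have pos: "A > 0" "B > 0"
    using a b by (simp_all add: A_def B_def)
  have diff: "A - B = 2 * exp (m * p) * sinh (c * p)"
    by (simp add: A_def B_def powr_diff_eq)
  have sinh: "sinh (c * p) \<noteq> 0"
    using assms c_nonzero by simp
  have ln_AB: "ln A = p * (m + c)" "ln B = p * (m - c)"
    using a b by (simp_all add: A_def B_def ln_powr m_def c_def field_simps)
  \<comment> \<open>The summand \<open>1 / p\<close> comes from the factor
    \<open>exp (1 / p)\<close> and cancels against the factor \<open>exp (- 1)\<close> of the
    identric mean.\<close>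
  have "ln (H_D p p a b) = 1 / p + (1 / p) * (- 1 + (A * ln A - B * ln B) / (A - B))"
    using pos by (simp add: H_D_def identric_mean_def A_def [symmetric] B_def [symmetric]
        ln_mult ln_powr ln_div)
  also have "\<dots> = (A * (m + c) - B * (m - c)) / (A - B)"
  proof -
    have "A * ln A - B * ln B = p * (A * (m + c) - B * (m - c))"
      by (simp add: ln_AB algebra_simps)
    then have "(A * ln A - B * ln B) / (A - B) = p * ((A * (m + c) - B * (m - c)) / (A - B))"
      by simp
    then show ?thesis
      using assms by (simp only:) (simp add: diff_divide_distrib)
  qed
  also have "A * (m + c) - B * (m - c) = 2 * exp (m * p) * (m * sinh (c * p) + c * cosh (c * p))"
    by (simp add: A_def B_def powr_a_eq powr_b_eq sinh_def cosh_def field_simps)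
  also have "\<dots> / (A - B) = m + c * cosh (c * p) / sinh (c * p)"
    using sinh by (simp add: diff field_simps)
  finally show ?thesis .
qed

text \<open>A convex \<open>S\<close> that omits 0 treats both half-lines together: the segment
  between \<open>p\<close> and \<open>q\<close> never meets the singularity at 0.\<close>

lemma ln_H_D_eq:
  assumes S: "convex S" "0 \<notin> S" and pq: "p \<in> S" "q \<in> S"
  shows "ln (H_D p q a b) = m + segment_mean (\<lambda>t. c * cosh (c * t) / sinh (c * t)) (p, q)"
proof (cases "p = q")
  case True
  moreover have "p \<noteq> 0"
    using assms by auto
  ultimately show ?thesis
    by (simp flip: ln_H_D_diag)
next
  case False
  have "p \<noteq> 0" "q \<noteq> 0"
    using assms by auto
  note nz = this[THEN powr_diff_nonzero]
  \<comment> \<open>Subtracting \<open>m * t\<close> from the antiderivative leaves only the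
    hyperbolic term in the derivative; the difference quotient of \<open>m * t\<close> gives back
    the constant \<open>m\<close>.\<close>
  have "segment_mean (\<lambda>t. c * cosh (c * t) / sinh (c * t)) (p, q)
      = ((ln \<bar>a powr p - b powr p\<bar> - m * p) - (ln \<bar>a powr q - b powr q\<bar> - m * q)) / (p - q)"
  proof (rule segment_mean_deriv[OF S(1) pq False])
    fix t assume "t \<in> S"
    then have "t \<noteq> 0" using S by auto
    show "((\<lambda>t. ln \<bar>a powr t - b powr t\<bar> - m * t) has_real_derivative
        c * cosh (c * t) / sinh (c * t)) (at t)"
      using DERIV_diff[OF ln_abs_powr_diff_deriv[OF \<open>t \<noteq> 0\<close>] DERIV_cmult_Id[of m]] by simp
  qed
  moreover have "ln (H_D p q a b) = (ln \<bar>a powr p - b powr p\<bar> - ln \<bar>a powr q - b powr q\<bar>) / (p - q)"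
    using False nz by (simp add: H_D_def ln_powr ln_div abs_divide)
  moreover have "m = (m * p - m * q) / (p - q)"
    using False by (simp flip: right_diff_distrib)
  ultimately show ?thesis
    by (simp add: diff_divide_distrib)
qed

end

section \<open>Transfer to the two quadrants\<close>

theorem theorem4p1:
  fixes a b :: real
  assumes "a > 0" and "b > 0" and "a \<noteq> b"
  shows "strictly_bivariate_log_convex_on ({0<..} \<times> {0<..}) (\<lambda>(p, q). H_D p q a b)
    \<and> bivariate_log_concave_on ({..<0} \<times> {..<0}) (\<lambda>(p, q). H_D p q a b)"
proof -
  define m c where "m = (ln a + ln b) / 2" and "c = (ln a - ln b) / 2"
  define g where "g t = c * cosh (c * t) / sinh (c * t)" for t
  let ?P = "{0<..} \<times> {0<..} :: (real \<times> real) set" and ?N = "{..<0} \<times> {..<0} :: (real \<times> real) set"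
  let ?H = "\<lambda>(p, q). H_D p q a b"
  have "c \<noteq> 0"
    using c_nonzero[OF assms] by (simp add: c_def)
  have pos: "?H z > 0" if "z \<in> ?P \<union> ?N" for z
    using that by (auto intro!: H_D_pos assms)
  have ln_P: "ln (?H z) = m + segment_mean g z" if "z \<in> ?P" for z
    using that ln_H_D_eq[OF assms, of "{0<..}"] by (auto simp: m_def c_def g_def [abs_def])
  have ln_N: "ln (?H z) = m + segment_mean g z" if "z \<in> ?N" for z
    using that ln_H_D_eq[OF assms, of "{..<0}"] by (auto simp: m_def c_def g_def [abs_def])
  have "continuous_on {0<..} g"
    unfolding g_def [abs_def] using \<open>c \<noteq> 0\<close> by (auto intro!: continuous_intros)
  moreover have "strictly_convex_on {0<..} g"
    unfolding g_def [abs_def] by (rule strictly_convex_on_scaled_coth[OF \<open>c \<noteq> 0\<close>])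
  ultimately have "strictly_convex_on ?P (segment_mean g)"
    by (intro strictly_convex_on_segment_mean)
  note strict = strictly_convex_onD[OF this]
  \<comment> \<open>The additive constant \<open>m\<close> drops out of convexity inequalities
    because the weights sum to 1.\<close>
  have shift: "u * (m + s) + v * (m + t) = m + (u * s + v * t)" if "u + v = 1" for u v s t :: real
  proof -
    have "u * (m + s) + v * (m + t) = (u + v) * m + (u * s + v * t)"
      by (simp add: algebra_simps)
    then show ?thesis
      using that by simp
  qed
  have convex_P: "convex ?P" and convex_N: "convex ?N"
    by (intro convex_Times convex_real_interval)+
  have "strictly_convex_on ?P (\<lambda>z. ln (?H z))"
    unfolding strictly_convex_on_def
  proof (intro conjI ballI allI impI convex_P)
    fix x y :: "real \<times> real" and u v :: real
    assume h: "x \<in> ?P" "y \<in> ?P" "0 < u" "0 < v" "x \<noteq> y" "u + v = 1"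
    have "u *\<^sub>R x + v *\<^sub>R y \<in> ?P"
      using convexD[OF convex_P, of x y u v] h by simp
    then show "ln (?H (u *\<^sub>R x + v *\<^sub>R y)) < u * ln (?H x) + v * ln (?H y)"
      using strict[OF h] by (simp only: ln_P h shift)
  qed
  moreover have "concave_on ?N (\<lambda>z. ln (?H z))"
    unfolding concave_on_iff
  proof (intro conjI ballI allI impI convex_N)
    fix x y :: "real \<times> real" and u v :: real
    assume h: "x \<in> ?N" "y \<in> ?N" "0 \<le> u" "0 \<le> v" "u + v = 1"
    have in_N: "u *\<^sub>R x + v *\<^sub>R y \<in> ?N"
      using convexD[OF convex_N, of x y u v] h by simp
    have odd: "segment_mean g (- z) = - segment_mean g z" for z
      by (rule segment_mean_odd) (simp add: g_def)
    have "u * segment_mean g x + v * segment_mean g y \<le> segment_mean g (u *\<^sub>R x + v *\<^sub>R y)"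
    \<comment> \<open>Strict convexity requires positive weights and distinct points; in the
      remaining cases equality holds. Otherwise the inequality is taken at the reflected points in
      the positive quadrant, and oddness reverses it.\<close>
    proof (cases "u = 0 \<or> v = 0 \<or> x = y")
      case True
      then show ?thesis
        using \<open>u + v = 1\<close> by (auto simp flip: distrib_right scaleR_left_distrib)
    next
      case False
      then have "segment_mean g (u *\<^sub>R (- x) + v *\<^sub>R (- y))
          < u * segment_mean g (- x) + v * segment_mean g (- y)"
        using h by (intro strict) auto
      also have "u *\<^sub>R (- x) + v *\<^sub>R (- y) = - (u *\<^sub>R x + v *\<^sub>R y)"
        by simp
      finally show ?thesis
        unfolding odd by simp
    qed
    then show "u * ln (?H x) + v * ln (?H y) \<le> ln (?H (u *\<^sub>R x + v *\<^sub>R y))"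
      by (simp only: ln_N h in_N shift)
  qed
  ultimately show ?thesis
    using pos by (simp add: strictly_bivariate_log_convex_on_def bivariate_log_concave_on_def)
qed

end
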